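(* Let $F:(0,\infty)\to\mathbb{R}$ be a nondecreasing function and let $\varphi:(0,\infty)\to(0,\infty)$ be such that for every $t\in(0,\infty)$ and every sequence $(t_n)$ in $(0,\infty)$ with $t_n>t$ for all $n$ and $t_n\to t$, $$\limsup_{n\to\infty}\varphi(t_n)>F(t^+)-F(t).$$ Let $(X,d)$ be a complete metric space and let $T:X\to X$ be a $(\varphi,F)$-contraction. Then $T$ is a Meir-Keeler contraction.
   Context: For nondecreasing $F:(0,\infty)\to\mathbb{R}$, $F(t^+)=\lim_{s\to t,\,s>t}F(s)$ denotes the right-hand limit at $t$. The $\limsup$ is taken in $[0,+\infty]$. Let $(X,d)$ be a metric space, $T:X\to X$, $F:(0,\infty)\to\mathbb{R}$ and $\varphi:(0,\infty)\to(0,\infty)$. $T$ is called a $(\varphi,F)$-contraction (nonlinear $F$-contraction) if for all $x,y\in X$ with $Tx\neq Ty$, $\varphi(d(x,y))+F(d(Tx,Ty))\le F(d(x,y))$. $T$ is called a Meir-Keeler contraction if for every $\varepsilon>0$ there exists $\delta>0$ such that for all $x,y\in X$: $\varepsilon\le d(x,y)<\varepsilon+\delta$ implies $d(Tx,Ty)<\varepsilon$. *)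

theory Defs
  imports "HOL-Analysis.Analysis"
begin

text \<open>Functions on the open half-line are total functions of type \<^typ>\<open>real \<Rightarrow> real\<close>, of which
  only the values on \<^term>\<open>{0<..} :: real set\<close> are ever used.  A metric space is a carrier \<open>M\<close> with a
  distance \<open>d\<close>, as in the locale \<open>Metric_space\<close>, and a self-map of it is a \<open>T \<in> M \<rightarrow> M\<close>.\<close>

definition right_limit :: "(real \<Rightarrow> real) \<Rightarrow> real \<Rightarrow> real" where
  "right_limit F t = Lim (at_right t) F"

definition phi_F_contraction ::
  "'a set \<Rightarrow> ('a \<Rightarrow> 'a \<Rightarrow> real) \<Rightarrow> (real \<Rightarrow> real) \<Rightarrow> (real \<Rightarrow> real) \<Rightarrow> ('a \<Rightarrow> 'a) \<Rightarrow> bool" where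
  "phi_F_contraction M d \<phi> F T \<longleftrightarrow>
     (\<forall>x\<in>M. \<forall>y\<in>M. T x \<noteq> T y \<longrightarrow> \<phi> (d x y) + F (d (T x) (T y)) \<le> F (d x y))"

definition Meir_Keeler_contraction ::
  "'a set \<Rightarrow> ('a \<Rightarrow> 'a \<Rightarrow> real) \<Rightarrow> ('a \<Rightarrow> 'a) \<Rightarrow> bool" where
  "Meir_Keeler_contraction M d T \<longleftrightarrow>
     (\<forall>\<epsilon>>0. \<exists>\<delta>>0. \<forall>x\<in>M. \<forall>y\<in>M. \<epsilon> \<le> d x y \<and> d x y < \<epsilon> + \<delta> \<longrightarrow> d (T x) (T y) < \<epsilon>)"

end

theory Submission imports Defs begin

text \<open>
  If the Meir--Keeler condition failed at some \<open>\<epsilon>\<close>, there would be pairs \<open>x\<^sub>n, y\<^sub>n\<close> whose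
  distances \<open>s n\<close> tend to \<open>\<epsilon>\<close> while the distances of their images stay at least \<open>\<epsilon>\<close>.
  Monotonicity of \<open>F\<close> turns the contraction inequality into
  \<open>\<phi> (s n) \<le> F (s n) - F \<epsilon>\<close>.  As \<open>\<phi>\<close> is positive this excludes \<open>s n = \<epsilon>\<close>, so \<open>s\<close>
  approaches \<open>\<epsilon>\<close> strictly from the right and \<open>F (s n)\<close> tends to the right limit of \<open>F\<close>
  at \<open>\<epsilon>\<close>.  Hence the upper limit of \<open>\<phi> (s n)\<close> is at most the jump of \<open>F\<close> at \<open>\<epsilon>\<close> from
  the right, which is what the growth hypothesis on \<open>\<phi>\<close> forbids.
\<close>

text \<open>A monotone function is bounded below to the right of \<open>t\<close> by its value at \<open>t\<close>, so its
  infimum there is finite and is the right limit; in particular \<^const>\<open>right_limit\<close>, which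
  returns an arbitrary value when there is no limit, is the actual one.\<close>

lemma tendsto_right_limit_mono_on:
  fixes F :: "real \<Rightarrow> real"
  assumes mono: "mono_on {0<..} F" and t: "0 < t"
  shows "(F \<longlongrightarrow> right_limit F t) (at_right t)"
proof -
  have "(F \<longlongrightarrow> Inf (F ` ({t<..} \<inter> UNIV))) (at t within ({t<..} \<inter> UNIV))"
  proof (rule Lim_right_bound)
    show "F a \<le> F b" if "t < a" "a \<le> b" for a b
      using that t by (intro mono_onD[OF mono]) auto
    show "F t \<le> F a" if "t < a" for a
      using that t by (intro mono_onD[OF mono]) auto
  qed
  then have lim: "(F \<longlongrightarrow> Inf (F ` {t<..})) (at_right t)"
    by simp
  then have "right_limit F t = Inf (F ` {t<..})"
    unfolding right_limit_def by (intro tendsto_Lim) simp_all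
  with lim show ?thesis
    by simp
qed

text \<open>The bound \<open>\<epsilon> \<le> d (T x) (T y)\<close> forces \<open>T x \<noteq> T y\<close>, so the contraction inequality applies,
  and it lets \<open>F \<epsilon>\<close> replace the unknown value \<open>F (d (T x) (T y))\<close>: what remains involves the
  single number \<open>d x y\<close>.\<close>

lemma phi_F_contraction_gap:
  assumes mono: "mono_on {0<..} F"
    and "Metric_space M d"
    and T: "T \<in> M \<rightarrow> M"
    and contr: "phi_F_contraction M d \<phi> F T"
    and xy: "x \<in> M" "y \<in> M"
    and \<epsilon>: "0 < \<epsilon>" "\<epsilon> \<le> d (T x) (T y)"
  shows "\<phi> (d x y) \<le> F (d x y) - F \<epsilon>"
proof -
  interpret Metric_space M d by fact
  have "T x \<in> M"
    using T xy by auto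
  then have "T x \<noteq> T y"
    using \<epsilon> by auto
  then have "\<phi> (d x y) + F (d (T x) (T y)) \<le> F (d x y)"
    using contr xy unfolding phi_F_contraction_def by blast
  moreover have "F \<epsilon> \<le> F (d (T x) (T y))"
    using \<epsilon> by (intro mono_onD[OF mono]) auto
  ultimately show ?thesis
    by simp
qed

theorem theorem10:
  fixes F \<phi> :: "real \<Rightarrow> real"
    and M :: "'a set" and d :: "'a \<Rightarrow> 'a \<Rightarrow> real" and T :: "'a \<Rightarrow> 'a"
  assumes "mono_on {0<..} F"
    and "\<phi> \<in> {0<..} \<rightarrow> {0<..}"
    and "\<And>(t :: real) (s :: nat \<Rightarrow> real).
           0 < t \<Longrightarrow> (\<And>n. t < s n) \<Longrightarrow> s \<longlonglongrightarrow> t \<Longrightarrow>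
           ereal (right_limit F t - F t) < limsup (\<lambda>n. ereal (\<phi> (s n)))"
    and "Metric_space M d"
    and "Metric_space.mcomplete M d"
    and "T \<in> M \<rightarrow> M"
    and "phi_F_contraction M d \<phi> F T"
  shows "Meir_Keeler_contraction M d T"
proof (rule ccontr)
  assume "\<not> Meir_Keeler_contraction M d T"
  then obtain \<epsilon> where \<epsilon>: "0 < \<epsilon>"
    and fail: "\<And>\<delta>. 0 < \<delta> \<Longrightarrow>
      \<exists>x\<in>M. \<exists>y\<in>M. \<epsilon> \<le> d x y \<and> d x y < \<epsilon> + \<delta> \<and> \<epsilon> \<le> d (T x) (T y)"
    unfolding Meir_Keeler_contraction_def not_all not_ex not_imp by (meson not_le)
  have "\<exists>s. \<epsilon> < s \<and> s < \<epsilon> + 1 / Suc n \<and> \<phi> s \<le> F s - F \<epsilon>" for n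
  proof -
    obtain x y where xy: "x \<in> M" "y \<in> M" "\<epsilon> \<le> d x y" "d x y < \<epsilon> + 1 / Suc n"
        "\<epsilon> \<le> d (T x) (T y)"
      using fail[of "1 / Suc n"] by auto
    have gap: "\<phi> (d x y) \<le> F (d x y) - F \<epsilon>"
      using phi_F_contraction_gap[OF assms(1,4,6,7)] xy \<epsilon> by blast
    have "0 < \<phi> (d x y)"
      using assms(2) xy(3) \<epsilon> by (auto dest!: funcset_mem[where x = "d x y"])
    with gap have "d x y \<noteq> \<epsilon>"
      by auto
    with xy gap show ?thesis
      by (intro exI[of _ "d x y"]) auto
  qed
  then obtain s where s: "\<And>n. \<epsilon> < s n" "\<And>n. s n < \<epsilon> + 1 / Suc n"
    and \<phi>_le: "\<And>n. \<phi> (s n) \<le> F (s n) - F \<epsilon>"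
    by metis
  have upper_lim: "(\<lambda>n. \<epsilon> + 1 / real (Suc n)) \<longlonglongrightarrow> \<epsilon>"
    using tendsto_add[OF tendsto_const lim_1_over_n[THEN LIMSEQ_Suc]] by simp
  have s_lim: "s \<longlonglongrightarrow> \<epsilon>"
    by (rule tendsto_sandwich[OF _ _ tendsto_const upper_lim])
      (use s in \<open>simp_all add: less_imp_le del: of_nat_Suc\<close>)
  then have "filterlim s (at_right \<epsilon>) sequentially"
    using s(1) by (intro tendsto_imp_filterlim_at_right always_eventually) auto
  with tendsto_right_limit_mono_on[OF assms(1) \<epsilon>]
  have "(\<lambda>n. F (s n)) \<longlonglongrightarrow> right_limit F \<epsilon>"
    by (rule filterlim_compose)
  then have "(\<lambda>n. ereal (F (s n) - F \<epsilon>)) \<longlonglongrightarrow> ereal (right_limit F \<epsilon> - F \<epsilon>)"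
    by (intro tendsto_intros)
  then have "limsup (\<lambda>n. ereal (F (s n) - F \<epsilon>)) = ereal (right_limit F \<epsilon> - F \<epsilon>)"
    by (intro lim_imp_Limsup) simp_all
  moreover have "limsup (\<lambda>n. ereal (\<phi> (s n))) \<le> limsup (\<lambda>n. ereal (F (s n) - F \<epsilon>))"
    using \<phi>_le by (intro Limsup_mono always_eventually) simp
  moreover have "ereal (right_limit F \<epsilon> - F \<epsilon>) < limsup (\<lambda>n. ereal (\<phi> (s n)))"
    using assms(3)[OF \<epsilon> s(1) s_lim] .
  ultimately show False
    by simp
qed

end
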